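(* If $\varphi\in L^\infty(\mathbb{R})$ and $0\notin sp(\varphi)$, then $P\varphi$ is bounded.
   Context: $P\varphi(x)=\int_0^x\varphi(t)\,dt$. The dual group of $\mathbb{R}$ is identified with $\mathbb{R}$: $\hat f(\lambda)=\int_{\mathbb{R}}f(x)e^{-ix\lambda}\,dx$ for $f\in L^1(\mathbb{R})$. $f^*(x)=\overline{f(-x)}$ and $f^**\varphi(x)=\int f^*(x-y)\varphi(y)\,dy$. For $\varphi\in L^\infty(\mathbb{R})$, $sp(\varphi)=\{\lambda\in\mathbb{R}:\hat f(\lambda)=0\text{ for all }f\in L^1(\mathbb{R})\text{ with }f^**\varphi=0\}$. *)

theory Defs
  imports "HOL-Analysis.Analysis"
begin

(* Elements of L^1 and L^infinity are represented by Lebesgue (not merely Borel) measurable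
   functions; all notions below depend only on the classes modulo null sets. Hence every integral
   is taken over lebesgue: a function that is not Borel measurable has the junk value 0 as
   its integral over lborel. *)

definition L1 :: "(real \<Rightarrow> complex) set" where
  "L1 = {f. integrable lebesgue f}"

definition Linfty :: "(real \<Rightarrow> complex) set" where
  "Linfty = {\<phi> \<in> borel_measurable lebesgue. \<exists>C. AE x in lebesgue. norm (\<phi> x) \<le> C}"

definition fourier :: "(real \<Rightarrow> complex) \<Rightarrow> real \<Rightarrow> complex" where
  "fourier f \<xi> = (LINT x|lebesgue. f x * exp (- \<i> * of_real x * of_real \<xi>))"

definition star :: "(real \<Rightarrow> complex) \<Rightarrow> real \<Rightarrow> complex" where
  "star f x = cnj (f (- x))"

definition conv :: "(real \<Rightarrow> complex) \<Rightarrow> (real \<Rightarrow> complex) \<Rightarrow> real \<Rightarrow> complex" where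
  "conv g \<phi> x = (LINT y|lebesgue. g (x - y) * \<phi> y)"

(* For f in L^1 and \<phi> in L^infinity the convolution is defined at every point and continuous,
   so its vanishing as an element of L^infinity is the same as its vanishing at every point. *)
definition sp :: "(real \<Rightarrow> complex) \<Rightarrow> real set" where
  "sp \<phi> = {\<xi>. \<forall>f\<in>L1. (\<forall>x. conv (star f) \<phi> x = 0) \<longrightarrow> fourier f \<xi> = 0}"

(* The interval integral is oriented: for x < 0 it is minus the integral over the interval
   from x to 0. *)
definition P :: "(real \<Rightarrow> complex) \<Rightarrow> real \<Rightarrow> complex" where
  "P \<phi> x = interval_lebesgue_integral lebesgue (ereal 0) (ereal x) \<phi>"

end

(* Write A\<psi>(x) for the mean of \<psi> over [x - h, x]; it is window h \<psi> x / h below.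
   The hypothesis gives an integrable g with g * \<phi> = 0 and nonzero integral c. If g * \<psi> = 0 then
   g * A\<psi> = 0, hence c A\<psi>(x) is the integral of g(y) (A\<psi>(x) - A\<psi>(x - y)) dy. As A\<psi> varies
   slowly for large h, this gives |A\<psi>| <= sup |\<psi>| / 2 for an h that depends only on g. On the other
   hand, the primitives of \<psi> and of A\<psi> differ by at most 2 h sup |\<psi>|. Iterating A from \<phi>, these
   differences add up to a geometric series. *)

theory Submission
  imports Defs
begin

section \<open>Primitives and windows of bounded Borel functions\<close>

definition primitive :: "(real \<Rightarrow> complex) \<Rightarrow> real \<Rightarrow> complex" where
  "primitive \<psi> x = (LBINT y=ereal 0..ereal x. \<psi> y)"

text \<open>A difference of values of the primitive, so that the Lipschitz bound applies to it
  directly; \<open>window_eq_integral\<close> recovers the form of a convolution with the indicator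
  of (0, h). The factor 1/h is left out until the iteration.\<close>

definition window :: "real \<Rightarrow> (real \<Rightarrow> complex) \<Rightarrow> real \<Rightarrow> complex" where
  "window h \<psi> x = primitive \<psi> x - primitive \<psi> (x - h)"

lemma interval_integrable_bounded:
  fixes \<psi> :: "real \<Rightarrow> complex"
  assumes [measurable]: "\<psi> \<in> borel_measurable borel" and "\<And>y. norm (\<psi> y) \<le> C"
  shows "interval_lebesgue_integrable lborel (ereal a) (ereal b) \<psi>"
proof -
  have "set_integrable lborel {u<..<v} \<psi>" for u v
    unfolding set_integrable_def
  proof (rule Bochner_Integration.integrable_bound)
    show "integrable lborel (\<lambda>x. indicator {u<..<v} x *\<^sub>R C)"
      by (cases "u \<le> v") simp_all
    show "AE x in lborel. norm (indicator {u<..<v} x *\<^sub>R \<psi> x) \<le> norm (indicator {u<..<v} x *\<^sub>R C)"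
      using assms(2) by (intro AE_I2) (auto simp: indicator_def intro: order_trans[OF _ abs_ge_self])
  qed measurable
  then show ?thesis
    by (simp add: interval_lebesgue_integrable_def)
qed

lemma primitive_diff:
  fixes \<psi> :: "real \<Rightarrow> complex"
  assumes "\<psi> \<in> borel_measurable borel" "\<And>y. norm (\<psi> y) \<le> C"
  shows "primitive \<psi> b - primitive \<psi> a = (LBINT y=ereal a..ereal b. \<psi> y)"
proof -
  have "(LBINT y=ereal 0..ereal a. \<psi> y) + (LBINT y=ereal a..ereal b. \<psi> y)
      = (LBINT y=ereal 0..ereal b. \<psi> y)"
    using interval_integrable_bounded[OF assms]
    by (intro interval_integral_sum) (simp flip: ereal_min ereal_max)
  then show ?thesis
    by (simp add: primitive_def algebra_simps)
qed

lemma norm_interval_integral_le: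
  fixes \<psi> :: "real \<Rightarrow> complex"
  assumes [measurable]: "\<psi> \<in> borel_measurable borel" and le: "\<And>y. norm (\<psi> y) \<le> C"
  shows "norm (LBINT y=ereal a..ereal b. \<psi> y) \<le> C * \<bar>b - a\<bar>"
proof -
  have *: "norm (LBINT y=ereal a..ereal b. \<psi> y) \<le> C * (b - a)" if "a \<le> b" for a b
  proof -
    have "norm (LBINT y:{a<..<b}. \<psi> y) \<le> (LBINT y:{a<..<b}. C)"
      unfolding set_lebesgue_integral_def
    proof (rule Bochner_Integration.integral_norm_bound_integral)
      show "integrable lborel (\<lambda>y. indicator {a<..<b} y *\<^sub>R \<psi> y)"
        using interval_integrable_bounded[OF assms, of a b] that
        by (simp add: interval_lebesgue_integrable_def set_integrable_def)
      show "integrable lborel (\<lambda>y. indicator {a<..<b} y *\<^sub>R C)"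
        using that by simp
      show "norm (indicator {a<..<b} y *\<^sub>R \<psi> y) \<le> indicator {a<..<b} y *\<^sub>R C" for y
        using le by (auto simp: indicator_def)
    qed
    also have "\<dots> = C * (b - a)"
      using that by (simp add: set_lebesgue_integral_def)
    finally show ?thesis
      using that by (simp add: interval_lebesgue_integral_def)
  qed
  show ?thesis
  proof (cases "a \<le> b")
    case False
    then show ?thesis
      using *[of b a] by (subst interval_integral_endpoints_reverse) simp
  qed (use *[of a b] in simp)
qed

lemma primitive_lipschitz:
  fixes \<psi> :: "real \<Rightarrow> complex"
  assumes "\<psi> \<in> borel_measurable borel" "\<And>y. norm (\<psi> y) \<le> C"
  shows "norm (primitive \<psi> b - primitive \<psi> a) \<le> C * \<bar>b - a\<bar>"
  using norm_interval_integral_le[OF assms] primitive_diff[OF assms] by simp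

lemma continuous_primitive:
  fixes \<psi> :: "real \<Rightarrow> complex"
  assumes "\<psi> \<in> borel_measurable borel" "\<And>y. norm (\<psi> y) \<le> C"
  shows "continuous_on UNIV (primitive \<psi>)"
proof (rule lipschitz_on_continuous_on)
  have "0 \<le> C"
    using assms(2)[of 0] norm_ge_zero order_trans by blast
  then show "C-lipschitz_on UNIV (primitive \<psi>)"
    using primitive_lipschitz[OF assms] by (intro lipschitz_onI) (auto simp: dist_norm dist_real_def)
qed

lemma borel_measurable_window:
  assumes "\<psi> \<in> borel_measurable borel" "\<And>y. norm (\<psi> y) \<le> C"
  shows "window h \<psi> \<in> borel_measurable borel"
proof -
  have [measurable]: "primitive \<psi> \<in> borel_measurable borel"
    using continuous_primitive[OF assms] by (rule borel_measurable_continuous_onI)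
  show ?thesis
    unfolding window_def by measurable
qed

text \<open>Four values of the primitive are paired in two ways: as two windows of length h, or as
  two increments over a distance |y|. The Lipschitz bound applied to each pairing gives one of the
  two terms in the minimum. The first keeps the bound integrable against any integrable g, the
  second makes it small compared with h for fixed y.\<close>

lemma window_increment:
  assumes "\<psi> \<in> borel_measurable borel" "\<And>y. norm (\<psi> y) \<le> C" "h \<ge> 0"
  shows "norm (window h \<psi> x - window h \<psi> (x - y)) \<le> 2 * C * min h \<bar>y\<bar>"
proof -
  note lip = primitive_lipschitz[OF assms(1,2)]
  have "norm (window h \<psi> x - window h \<psi> (x - y))
      \<le> norm (primitive \<psi> x - primitive \<psi> (x - h))
        + norm (primitive \<psi> (x - y) - primitive \<psi> (x - y - h))"
    unfolding window_def by (rule norm_triangle_ineq4)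
  also have "\<dots> \<le> 2 * C * h"
    using lip[of x "x - h"] lip[of "x - y" "x - y - h"] assms(3) by simp
  finally have 1: "norm (window h \<psi> x - window h \<psi> (x - y)) \<le> 2 * C * h" .
  have "norm (window h \<psi> x - window h \<psi> (x - y))
      = norm ((primitive \<psi> x - primitive \<psi> (x - y))
        - (primitive \<psi> (x - h) - primitive \<psi> (x - y - h)))"
    unfolding window_def by (simp add: algebra_simps)
  also have "\<dots> \<le> norm (primitive \<psi> x - primitive \<psi> (x - y))
        + norm (primitive \<psi> (x - h) - primitive \<psi> (x - y - h))"
    by (rule norm_triangle_ineq4)
  also have "\<dots> \<le> 2 * C * \<bar>y\<bar>"
    using lip[of x "x - y"] lip[of "x - h" "x - y - h"] by simp
  finally show ?thesis
    using 1 by (simp add: min_def)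
qed

section \<open>Windows of functions annihilated by an integrable kernel\<close>

lemma window_eq_integral:
  assumes "\<psi> \<in> borel_measurable borel" "\<And>y. norm (\<psi> y) \<le> C" "h \<ge> 0"
  shows "window h \<psi> x = (LINT s|lborel. indicator {0<..<h} s *\<^sub>R \<psi> (x - s))"
proof -
  have "window h \<psi> x = (LINT y|lborel. indicator {x - h<..<x} y *\<^sub>R \<psi> y)"
    using assms(3) unfolding window_def primitive_diff[OF assms(1,2)]
    by (simp add: interval_lebesgue_integral_def set_lebesgue_integral_def)
  also have "\<dots> = (LINT s|lborel. indicator {x - h<..<x} (x + -1 * s) *\<^sub>R \<psi> (x + -1 * s))"
    by (subst lborel_integral_real_affine[where c = "-1" and t = x]) simp_all
  also have "\<dots> = (LINT s|lborel. indicator {0<..<h} s *\<^sub>R \<psi> (x - s))"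
    by (intro Bochner_Integration.integral_cong) (auto simp: indicator_def)
  finally show ?thesis .
qed

text \<open>The window is a superposition of translates of \<psi>, and g annihilates each of them
  because \<open>zero\<close> holds at every point. Fubini moves the convolution inside the
  superposition.\<close>

lemma convolution_window_eq_0:
  fixes g \<psi> :: "real \<Rightarrow> complex"
  assumes g: "integrable lborel g"
    and \<psi>[measurable]: "\<psi> \<in> borel_measurable borel" and C: "\<And>y. norm (\<psi> y) \<le> C" and "h \<ge> 0"
    and zero: "\<And>x. (LINT y|lborel. g (x - y) * \<psi> y) = 0"
  shows "(LINT y|lborel. g (x - y) * window h \<psi> y) = 0"
proof -
  have [measurable]: "g \<in> borel_measurable borel"
    using g by auto
  have gx: "integrable lborel (\<lambda>y. g (x - y))" for x
    using lborel_integrable_real_affine[OF g, of "-1" x] by simp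
  define F where "F y s = g (x - y) * (indicator {0<..<h} s *\<^sub>R \<psi> (y - s))" for y s
  have [measurable]: "case_prod F \<in> borel_measurable (lborel \<Otimes>\<^sub>M lborel)"
    unfolding F_def by measurable
  have ind: "integrable lborel (\<lambda>s. indicator {0<..<h} s *\<^sub>R C)"
    using \<open>h \<ge> 0\<close> by simp
  \<comment> \<open>The majorant is a product of a function of y and a function of s, so its
    integrability on the plane reduces to two integrals in one variable.\<close>
  have "integrable (lborel \<Otimes>\<^sub>M lborel) (\<lambda>(y,s). norm (g (x - y)) * (indicator {0<..<h} s *\<^sub>R C))"
  proof (rule lborel_pair.Fubini_integrable)
    have "integrable lborel (\<lambda>y. norm (g (x - y)) * (LINT s|lborel. norm (indicator {0<..<h} s *\<^sub>R C)))"
      using gx by (intro integrable_mult_left integrable_norm)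
    then show "integrable lborel (\<lambda>y. LINT s|lborel. norm (case (y,s) of (y,s) \<Rightarrow>
        norm (g (x - y)) * (indicator {0<..<h} s *\<^sub>R C)))"
      by (simp add: norm_mult abs_mult)
    show "AE y in lborel. integrable lborel (\<lambda>s. case (y,s) of (y,s) \<Rightarrow>
        norm (g (x - y)) * (indicator {0<..<h} s *\<^sub>R C))"
      using ind by (intro AE_I2) (simp only: prod.case integrable_mult_right)
  qed measurable
  then have int: "integrable (lborel \<Otimes>\<^sub>M lborel) (case_prod F)"
  proof (rule Bochner_Integration.integrable_bound)
    show "AE p in lborel \<Otimes>\<^sub>M lborel. norm (case p of (y, s) \<Rightarrow> F y s)
        \<le> norm (case p of (y, s) \<Rightarrow> norm (g (x - y)) * (indicator {0<..<h} s *\<^sub>R C))"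
      using C by (intro AE_I2) (auto simp: F_def norm_mult indicator_def split: prod.split
        intro!: mult_left_mono order_trans[OF _ abs_ge_self])
  qed measurable
  \<comment> \<open>For fixed s, substituting y + s for y gives the convolution of g with \<psi> at
    the point x - s.\<close>
  have inner: "(LINT y|lborel. F y s) = 0" for s
  proof -
    have "(LINT y|lborel. F y s) = indicator {0<..<h} s *\<^sub>R (LINT y|lborel. g (x - y) * \<psi> (y - s))"
      unfolding F_def by (simp add: mult.left_commute flip: integral_scaleR_right)
    also have "(LINT y|lborel. g (x - y) * \<psi> (y - s)) = (LINT y|lborel. g (x - s - y) * \<psi> y)"
      by (subst lborel_integral_real_affine[where c = 1 and t = s]) (simp_all add: algebra_simps)
    finally show ?thesis
      using zero by simp
  qed
  have "(LINT y|lborel. g (x - y) * window h \<psi> y) = (LINT y|lborel. LINT s|lborel. F y s)"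
    unfolding window_eq_integral[OF \<psi> C \<open>h \<ge> 0\<close>] F_def integral_mult_right_zero by (rule refl)
  also have "\<dots> = (LINT s|lborel. LINT y|lborel. F y s)"
    using lborel_pair.Fubini_integral[OF int] by simp
  also have "\<dots> = 0"
    by (simp add: inner)
  finally show ?thesis .
qed

text \<open>The Lipschitz bound alone gives only C h for a window. Here the vanishing convolution
  replaces the value of the window by its increments weighted by g. The resulting truncated first
  moment of g is o(h), and this is the gain over C h.\<close>

lemma window_bound:
  fixes g \<psi> :: "real \<Rightarrow> complex"
  assumes g: "integrable lborel g"
    and \<psi>: "\<psi> \<in> borel_measurable borel" and C: "\<And>y. norm (\<psi> y) \<le> C" and "h \<ge> 0"
    and zero: "\<And>x. (LINT y|lborel. g (x - y) * \<psi> y) = 0"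
  shows "norm (integral\<^sup>L lborel g) * norm (window h \<psi> x)
    \<le> 2 * C * (LINT y|lborel. norm (g y) * min h \<bar>y\<bar>)"
proof -
  let ?w = "window h \<psi>"
  have [measurable]: "g \<in> borel_measurable borel"
    using g by auto
  have [measurable]: "?w \<in> borel_measurable borel"
    using borel_measurable_window[OF \<psi> C] .
  \<comment> \<open>The first moment of g may be infinite; truncating |y| at h leaves the majorant h
    |g|.\<close>
  have min_int: "integrable lborel (\<lambda>y. norm (g y) * min h \<bar>y\<bar>)"
  proof (rule Bochner_Integration.integrable_bound)
    show "integrable lborel (\<lambda>y. norm (g y) * h)"
      using g by simp
    show "AE y in lborel. norm (norm (g y) * min h \<bar>y\<bar>) \<le> norm (norm (g y) * h)"
      using \<open>h \<ge> 0\<close> by (intro AE_I2) (auto simp: abs_mult intro!: mult_left_mono)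
  qed measurable
  have diff_int: "integrable lborel (\<lambda>y. g y * (?w x - ?w (x - y)))"
  proof (rule Bochner_Integration.integrable_bound)
    show "integrable lborel (\<lambda>y. 2 * C * (norm (g y) * min h \<bar>y\<bar>))"
      using min_int by simp
    show "AE y in lborel. norm (g y * (?w x - ?w (x - y))) \<le> norm (2 * C * (norm (g y) * min h \<bar>y\<bar>))"
    proof (intro AE_I2)
      fix y
      have "norm (g y * (?w x - ?w (x - y))) \<le> norm (g y) * (2 * C * min h \<bar>y\<bar>)"
        using window_increment[OF \<psi> C \<open>h \<ge> 0\<close>] by (simp add: norm_mult mult_left_mono)
      then show "norm (g y * (?w x - ?w (x - y))) \<le> norm (2 * C * (norm (g y) * min h \<bar>y\<bar>))"
        by (simp add: mult_ac)
    qed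
  qed measurable
  have g_int: "integrable lborel (\<lambda>y. g y * ?w x)"
    using g by simp
  have "(LINT y|lborel. g y * ?w (x - y)) = (LINT y|lborel. g (x - y) * ?w y)"
    by (subst lborel_integral_real_affine[where c = "-1" and t = x]) simp_all
  then have "(LINT y|lborel. g y * ?w (x - y)) = 0"
    using convolution_window_eq_0[OF assms] by simp
  moreover have "(LINT y|lborel. g y * ?w x) - (LINT y|lborel. g y * (?w x - ?w (x - y)))
      = (LINT y|lborel. g y * ?w (x - y))"
    by (subst Bochner_Integration.integral_diff[OF g_int diff_int, symmetric]) (simp add: algebra_simps)
  ultimately have "integral\<^sup>L lborel g * ?w x = (LINT y|lborel. g y * (?w x - ?w (x - y)))"
    using g by simp
  also have "norm \<dots> \<le> (LINT y|lborel. 2 * C * (norm (g y) * min h \<bar>y\<bar>))"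
  proof (rule Bochner_Integration.integral_norm_bound_integral[OF diff_int])
    show "integrable lborel (\<lambda>y. 2 * C * (norm (g y) * min h \<bar>y\<bar>))"
      using min_int by simp
    show "norm (g y * (?w x - ?w (x - y))) \<le> 2 * C * (norm (g y) * min h \<bar>y\<bar>)" for y
    proof -
      have "norm (g y * (?w x - ?w (x - y))) \<le> norm (g y) * (2 * C * min h \<bar>y\<bar>)"
        using window_increment[OF \<psi> C \<open>h \<ge> 0\<close>] by (simp add: norm_mult mult_left_mono)
      then show ?thesis
        by (simp add: mult_ac)
    qed
  qed
  finally show ?thesis
    by (simp add: norm_mult)
qed

text \<open>Dominated convergence with majorant |g|: for each fixed y the ratio |y| / h tends to 0.
  The window lengths run through the positive integers to give a sequence.\<close>

lemma tail_moment_tendsto_0: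
  fixes g :: "real \<Rightarrow> complex"
  assumes g: "integrable lborel g"
  shows "(\<lambda>n. LINT y|lborel. norm (g y) * min 1 (\<bar>y\<bar> / real (Suc n))) \<longlonglongrightarrow> 0"
proof -
  have [measurable]: "g \<in> borel_measurable borel"
    using g by auto
  have "(\<lambda>n. LINT y|lborel. norm (g y) * min 1 (\<bar>y\<bar> / real (Suc n))) \<longlonglongrightarrow> (LINT y|(lborel::real measure). (0::real))"
  proof (rule integral_dominated_convergence)
    show "integrable lborel (\<lambda>y. norm (g y))"
      using g by simp
    show "AE y in lborel. norm (norm (g y) * min 1 (\<bar>y\<bar> / real (Suc n))) \<le> norm (g y)" for n
      by (intro AE_I2) (auto simp: abs_mult intro!: mult_left_le)
    show "AE y in lborel. (\<lambda>n. norm (g y) * min 1 (\<bar>y\<bar> / real (Suc n))) \<longlonglongrightarrow> 0"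
    proof (intro AE_I2)
      fix y :: real
      have "(\<lambda>n. \<bar>y\<bar> / real (Suc n)) \<longlonglongrightarrow> 0"
        using LIMSEQ_Suc lim_const_over_n by blast
      then have "(\<lambda>n. norm (g y) * min 1 (\<bar>y\<bar> / real (Suc n))) \<longlonglongrightarrow> norm (g y) * min 1 0"
        by (intro tendsto_intros)
      then show "(\<lambda>n. norm (g y) * min 1 (\<bar>y\<bar> / real (Suc n))) \<longlonglongrightarrow> 0"
        by simp
    qed
  qed measurable
  then show ?thesis
    by simp
qed

section \<open>Comparing the primitive of a function with that of its window\<close>

lemma interval_integral_translate:
  fixes f :: "real \<Rightarrow> complex"
  shows "(LBINT y=ereal a..ereal b. f (y - h)) = (LBINT y=ereal (a - h)..ereal (b - h). f y)"
proof -
  have "(LBINT y:{a<..<b}. f (y - h)) = (LBINT y:{a - h<..<b - h}. f y)" for a b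
    unfolding set_lebesgue_integral_def
    by (subst lborel_integral_real_affine[where c = 1 and t = h])
      (auto simp: indicator_def algebra_simps intro!: Bochner_Integration.integral_cong)
  then show ?thesis
    by (simp add: interval_lebesgue_integral_def)
qed

text \<open>Integrating ?\<Psi>(y) - ?\<Psi>(y - h) from 0 to x telescopes, leaving the integral of
  ?\<Psi> over [x - h, x] minus the one over [-h, 0]. Each is within C h^2 of h times the value of
  ?\<Psi> at the right endpoint, and ?\<Psi>(0) = 0. The point is that the error does not grow with
  x.\<close>

lemma primitive_window:
  fixes \<psi> :: "real \<Rightarrow> complex"
  assumes \<psi>: "\<psi> \<in> borel_measurable borel" and C: "\<And>y. norm (\<psi> y) \<le> C" and "h > 0"
  shows "norm (of_real h * primitive \<psi> x - primitive (window h \<psi>) x) \<le> 2 * C * h\<^sup>2"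
proof -
  let ?\<Psi> = "primitive \<psi>"
  have cont: "continuous_on UNIV ?\<Psi>"
    by (rule continuous_primitive[OF \<psi> C])
  then have [measurable]: "?\<Psi> \<in> borel_measurable borel"
    by (rule borel_measurable_continuous_onI)
  have int: "interval_lebesgue_integrable lborel (ereal a) (ereal b) ?\<Psi>" for a b
    using cont by (intro interval_integrable_isCont) (simp add: continuous_on_eq_continuous_at)
  have "continuous_on UNIV (\<lambda>y. ?\<Psi> (y - h))"
    by (intro continuous_on_compose2[OF cont] continuous_intros) simp
  then have int': "interval_lebesgue_integrable lborel (ereal a) (ereal b) (\<lambda>y. ?\<Psi> (y - h))" for a b
    by (intro interval_integrable_isCont) (simp add: continuous_on_eq_continuous_at)
  have split: "(LBINT y=ereal a..ereal b. ?\<Psi> y) + (LBINT y=ereal b..ereal c. ?\<Psi> y)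
      = (LBINT y=ereal a..ereal c. ?\<Psi> y)" for a b c
    using int by (intro interval_integral_sum) (simp flip: ereal_min ereal_max)
  have near: "norm (of_real h * ?\<Psi> x - (LBINT y=ereal (x - h)..ereal x. ?\<Psi> y)) \<le> C * h\<^sup>2" for x
  proof -
    have "0 \<le> C"
      using C[of 0] norm_ge_zero order_trans by blast
    have *: "(LBINT y=ereal (x - h)..ereal x. ?\<Psi> x) = of_real h * ?\<Psi> x"
      using \<open>h > 0\<close> by (simp add: interval_lebesgue_integral_def set_lebesgue_integral_def scaleR_conv_of_real)
    have "of_real h * ?\<Psi> x - (LBINT y=ereal (x - h)..ereal x. ?\<Psi> y)
        = (LBINT y=ereal (x - h)..ereal x. ?\<Psi> x - ?\<Psi> y)"
      unfolding *[symmetric]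
      by (intro interval_lebesgue_integral_diff(2)[symmetric] int interval_integrable_isCont
          continuous_const)
    \<comment> \<open>The indicator makes the bound C h hold for every y, as
      \<open>norm_interval_integral_le\<close> demands, and not only inside the interval of
      integration.\<close>
    also have "\<dots> = (LBINT y=ereal (x - h)..ereal x. indicator {x - h<..<x} y *\<^sub>R (?\<Psi> x - ?\<Psi> y))"
      using \<open>h > 0\<close> by (intro interval_integral_cong) (simp add: min_def max_def)
    also have "norm \<dots> \<le> C * h * \<bar>x - (x - h)\<bar>"
    proof (rule norm_interval_integral_le)
      show "norm (indicator {x - h<..<x} y *\<^sub>R (?\<Psi> x - ?\<Psi> y)) \<le> C * h" for y
        using primitive_lipschitz[OF \<psi> C, of x y] \<open>0 \<le> C\<close> \<open>h > 0\<close>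
          mult_left_mono[of "\<bar>x - y\<bar>" h C]
        by (auto simp: indicator_def)
    qed measurable
    finally show ?thesis
      using \<open>h > 0\<close> by (simp add: power2_eq_square mult.assoc)
  qed
  have "primitive (window h \<psi>) x
      = (LBINT y=ereal 0..ereal x. ?\<Psi> y) - (LBINT y=ereal 0..ereal x. ?\<Psi> (y - h))"
    unfolding primitive_def[of "window h \<psi>"] window_def
    by (intro interval_lebesgue_integral_diff(2) int int')
  \<comment> \<open>After translation the second integral runs from -h to x - h. Splitting the
    integral from -h to x once at 0 and once at x - h gives the identity; orientation makes this
    valid for every sign of x.\<close>
  also have "\<dots> = (LBINT y=ereal (x - h)..ereal x. ?\<Psi> y) - (LBINT y=ereal (0 - h)..ereal 0. ?\<Psi> y)"
    using split[of "0 - h" 0 x] split[of "0 - h" "x - h" x]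
    unfolding interval_integral_translate by (simp add: algebra_simps)
  \<comment> \<open>The term with ?\<Psi> 0 is zero; it is inserted so that both brackets are
    instances of \<open>near\<close>.\<close>
  finally have "of_real h * ?\<Psi> x - primitive (window h \<psi>) x
      = (of_real h * ?\<Psi> x - (LBINT y=ereal (x - h)..ereal x. ?\<Psi> y))
        - (of_real h * ?\<Psi> 0 - (LBINT y=ereal (0 - h)..ereal 0. ?\<Psi> y))"
    by (simp add: primitive_def zero_ereal_def[symmetric])
  also have "norm \<dots> \<le> C * h\<^sup>2 + C * h\<^sup>2"
    by (rule order_trans[OF norm_triangle_ineq4 add_mono[OF near near]])
  finally show ?thesis
    by simp
qed

section \<open>Iterating the averages\<close>

lemma primitive_bounded:
  fixes g \<phi> :: "real \<Rightarrow> complex"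
  assumes g: "integrable lborel g" and g0: "integral\<^sup>L lborel g \<noteq> 0"
    and \<phi>: "\<phi> \<in> borel_measurable borel" "\<And>y. norm (\<phi> y) \<le> C"
    and zero: "\<And>x. (LINT y|lborel. g (x - y) * \<phi> y) = 0"
  shows "bounded (range (primitive \<phi>))"
proof -
  let ?c = "norm (integral\<^sup>L lborel g)"
  \<comment> \<open>With the factor 2 in \<open>window_bound\<close>, a quarter of |c| makes one
    averaging halve the supremum.\<close>
  have "?c / 4 > 0"
    using g0 by simp
  from order_tendstoD(2)[OF tail_moment_tendsto_0[OF g] this]
  obtain n where n: "(LINT y|lborel. norm (g y) * min 1 (\<bar>y\<bar> / real (Suc n))) < ?c / 4"
    by (auto simp: eventually_sequentially)
  define h where "h = real (Suc n)"
  have h: "h > 0"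
    by (simp add: h_def)
  have "(LINT y|lborel. norm (g y) * min h \<bar>y\<bar>)
      = (LINT y|lborel. h * (norm (g y) * min 1 (\<bar>y\<bar> / h)))"
    using h by (intro Bochner_Integration.integral_cong) (auto simp: min_def field_simps)
  then have small: "(LINT y|lborel. norm (g y) * min h \<bar>y\<bar>) \<le> h * (?c / 4)"
    using n h by (simp add: h_def[symmetric] del: of_nat_Suc)
  \<comment> \<open>This is stated for all \<psi> and K because the induction passes from \<psi> to
    its average \<theta> and from K to K / 2, while h stays fixed. One averaging costs 2 h K, and 4
    h K is the sum of these costs over K, K / 2, K / 4, and so on. The other summand is the trivial
    linear bound for the primitive after N averagings.\<close>
  have claim: "norm (primitive \<psi> x) \<le> 4 * h * K + K * \<bar>x\<bar> / 2 ^ N"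
    if "\<psi> \<in> borel_measurable borel" "\<And>y. norm (\<psi> y) \<le> K"
      "\<And>x. (LINT y|lborel. g (x - y) * \<psi> y) = 0" for \<psi> K x N
    using that
  proof (induction N arbitrary: \<psi> K)
    case 0
    have "0 \<le> K"
      using 0(2)[of 0] norm_ge_zero order_trans by blast
    then have "0 \<le> 4 * h * K"
      using h by simp
    moreover have "norm (primitive \<psi> x) \<le> K * \<bar>x\<bar>"
      using norm_interval_integral_le[OF 0(1,2), of 0 x] by (simp add: primitive_def)
    ultimately show ?case
      unfolding power_0 div_by_1 by linarith
  next
    case (Suc N)
    have "0 \<le> K"
      using Suc.prems(2)[of 0] norm_ge_zero order_trans by blast
    define \<theta> where "\<theta> y = window h \<psi> y / of_real h" for y
    have w: "window h \<psi> \<in> borel_measurable borel"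
      by (rule borel_measurable_window[OF Suc.prems(1,2)])
    have "norm (\<theta> y) \<le> K / 2" for y
    proof -
      have "?c * norm (window h \<psi> y) \<le> 2 * K * (h * (?c / 4))"
        using window_bound[OF g Suc.prems(1,2) less_imp_le[OF h] Suc.prems(3), of y]
          mult_left_mono[OF small, of "2 * K"] \<open>0 \<le> K\<close> by simp
      then have "?c * norm (window h \<psi> y) \<le> ?c * (K * h / 2)"
        by (simp add: mult_ac)
      then show ?thesis
        using g0 h by (simp add: \<theta>_def norm_divide field_simps)
    qed
    moreover have "(LINT y|lborel. g (x - y) * \<theta> y) = 0" for x
      using convolution_window_eq_0[OF g Suc.prems(1,2) less_imp_le[OF h] Suc.prems(3), of x]
      by (simp add: \<theta>_def)
    moreover have "\<theta> \<in> borel_measurable borel"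
      using w unfolding \<theta>_def by measurable
    ultimately have \<theta>: "norm (primitive \<theta> x) \<le> 4 * h * (K / 2) + K / 2 * \<bar>x\<bar> / 2 ^ N"
      by (intro Suc.IH)
    have "primitive (window h \<psi>) x = of_real h * primitive \<theta> x"
      using h by (simp add: primitive_def \<theta>_def)
    \<comment> \<open>\<open>primitive_window\<close> compares with the primitive of the window,
      which is h times that of \<theta>; cancelling h turns the error 2 K h^2 into 2 K h.\<close>
    then have "norm (of_real h * (primitive \<psi> x - primitive \<theta> x)) \<le> 2 * K * h\<^sup>2"
      using primitive_window[OF Suc.prems(1,2) h, of x] by (simp add: right_diff_distrib)
    then have "norm (primitive \<psi> x - primitive \<theta> x) \<le> 2 * K * h"
      using h by (simp add: norm_mult power2_eq_square mult.left_commute)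
    then have "norm (primitive \<psi> x) \<le> 2 * K * h + norm (primitive \<theta> x)"
      using norm_triangle_sub[of "primitive \<psi> x" "primitive \<theta> x"] by linarith
    moreover have "K / 2 * \<bar>x\<bar> / 2 ^ N = K * \<bar>x\<bar> / 2 ^ Suc N"
      by simp
    moreover have "4 * h * (K / 2) = 2 * K * h" "4 * h * K = 2 * K * h + 2 * K * h"
      by simp_all
    ultimately show ?case
      using \<theta> by linarith
  qed
  \<comment> \<open>For fixed x the linear term disappears as N tends to infinity, which leaves a
    bound independent of x.\<close>
  have "norm (primitive \<phi> x) \<le> 4 * h * C" for x
  proof (rule LIMSEQ_le_const)
    have "(\<lambda>N. 4 * h * C + C * \<bar>x\<bar> * (1 / 2) ^ N) \<longlonglongrightarrow> 4 * h * C + C * \<bar>x\<bar> * 0"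
      by (intro tendsto_intros LIMSEQ_power_zero) simp
    then show "(\<lambda>N. 4 * h * C + C * \<bar>x\<bar> / 2 ^ N) \<longlonglongrightarrow> 4 * h * C"
      by (simp add: power_one_over)
    show "\<exists>M. \<forall>N\<ge>M. norm (primitive \<phi> x) \<le> 4 * h * C + C * \<bar>x\<bar> / 2 ^ N"
      using claim[OF \<phi> zero] by blast
  qed
  then show ?thesis
    by (auto simp: bounded_iff)
qed

section \<open>Passing from Lebesgue measurable functions to Borel representatives\<close>

lemma lebesgue_measurable_borel_version:
  fixes f :: "real \<Rightarrow> complex"
  assumes "f \<in> borel_measurable lebesgue"
  obtains f' where "f' \<in> borel_measurable borel" "AE x in lebesgue. f x = f' x"
proof -
  have "(\<lambda>x. Re (f x)) \<in> borel_measurable lebesgue" "(\<lambda>x. Im (f x)) \<in> borel_measurable lebesgue"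
    using assms by measurable
  then obtain u v where [measurable]: "u \<in> borel_measurable lborel" "v \<in> borel_measurable lborel"
    and ae: "AE x in lborel. Re (f x) = u x" "AE x in lborel. Im (f x) = v x"
    using completion_ex_borel_measurable_real by metis
  show ?thesis
  proof
    show "(\<lambda>x. of_real (u x) + \<i> * of_real (v x)) \<in> borel_measurable borel"
      by measurable
    have "AE x in lborel. f x = of_real (u x) + \<i> * of_real (v x)"
      using ae by eventually_elim (simp add: complex_eq_iff)
    then show "AE x in lebesgue. f x = of_real (u x) + \<i> * of_real (v x)"
      by (rule AE_completion)
  qed
qed

text \<open>Null sets are invariant under translation. This serves the convolution, where f enters
  as f(y - x) and has to be replaced by its Borel version for almost every y.\<close>

lemma AE_lebesgue_translate:
  fixes a :: real
  assumes "AE x in lebesgue. Q x"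
  shows "AE x in lebesgue. Q (x - a)"
proof -
  have "negligible {x. \<not> Q x}"
    using assms by (simp add: completion.AE_iff_null_sets negligible_iff_null_sets)
  then have "negligible ((+) a ` {x. \<not> Q x})"
    by (rule negligible_translation)
  also have "(+) a ` {x. \<not> Q x} = {x. \<not> Q (x - a)}"
    by (auto simp: image_iff) (metis add.commute diff_add_cancel)
  finally show ?thesis
    by (simp add: completion.AE_iff_null_sets negligible_iff_null_sets)
qed

theorem corollary5p4:
  fixes \<phi> :: "real \<Rightarrow> complex"
  assumes "\<phi> \<in> Linfty" and "0 \<notin> sp \<phi>"
  shows "bounded (range (P \<phi>))"
proof -
  obtain f where f: "integrable lebesgue f" and zero: "\<And>x. conv (star f) \<phi> x = 0"
    and f0: "fourier f 0 \<noteq> 0"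
    using assms(2) by (auto simp: sp_def L1_def)
  obtain C where \<phi>[measurable]: "\<phi> \<in> borel_measurable lebesgue"
    and C: "AE x in lebesgue. norm (\<phi> x) \<le> C"
    using assms(1) by (auto simp: Linfty_def)
  have [measurable]: "f \<in> borel_measurable lebesgue"
    using f by auto
  obtain f' where f'[measurable]: "f' \<in> borel_measurable borel" and ff': "AE x in lebesgue. f x = f' x"
    using lebesgue_measurable_borel_version[of f] by auto
  obtain \<phi>0 where [measurable]: "\<phi>0 \<in> borel_measurable borel" and \<phi>0: "AE x in lebesgue. \<phi> x = \<phi>0 x"
    using lebesgue_measurable_borel_version[OF \<phi>] by auto
  \<comment> \<open>Truncation turns the almost everywhere bound into one at every point. The new
    value 0 must obey it too, hence the maximum with 0 in \<open>C'\<close>.\<close>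
  define \<phi>' where "\<phi>' x = (if norm (\<phi>0 x) \<le> C then \<phi>0 x else 0)" for x
  define C' where "C' = max C 0"
  have \<phi>'[measurable]: "\<phi>' \<in> borel_measurable borel"
    unfolding \<phi>'_def by measurable
  have C': "norm (\<phi>' x) \<le> C'" for x
    by (auto simp: \<phi>'_def C'_def)
  have \<phi>\<phi>': "AE x in lebesgue. \<phi> x = \<phi>' x"
    using \<phi>0 C by eventually_elim (simp add: \<phi>'_def)
  define g where "g x = cnj (f' (- x))" for x
  have lebesgueI: "u \<in> borel_measurable lebesgue" if "u \<in> borel_measurable borel" for u :: "real \<Rightarrow> complex"
    using that by (simp add: measurable_completion)
  have "integrable lebesgue f'"
    using integrable_cong_AE[OF _ _ ff'] f lebesgueI[OF f'] by auto
  then have f'_int: "integrable lborel f'"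
    by (simp add: integrable_completion)
  then have "integrable lborel (\<lambda>x. f' (0 + -1 * x))"
    by (rule lborel_integrable_real_affine) simp
  then have g: "integrable lborel g"
    by (simp add: g_def[abs_def])
  have [measurable]: "g \<in> borel_measurable borel"
    using g by auto
  \<comment> \<open>At frequency 0 the exponential is 1. As reflection preserves the integral, the
    integral of g is the conjugate of \<open>fourier f 0\<close>, so it is nonzero.\<close>
  have "fourier f 0 = integral\<^sup>L lebesgue f"
    by (simp add: fourier_def)
  also have "\<dots> = integral\<^sup>L lebesgue f'"
    by (rule integral_cong_AE[OF _ lebesgueI[OF f'] ff']) measurable
  also have "\<dots> = integral\<^sup>L lborel f'"
    by (simp add: integral_completion)
  also have "\<dots> = (LINT x|lborel. f' (- x))"
    by (subst lborel_integral_real_affine[where c = "-1" and t = 0]) simp_all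
  also have "\<dots> = cnj (integral\<^sup>L lborel g)"
    by (simp add: g_def[abs_def])
  finally have g0: "integral\<^sup>L lborel g \<noteq> 0"
    using f0 by auto
  have "(LINT y|lborel. g (x - y) * \<phi>' y) = 0" for x
  proof -
    have ae: "AE y in lebesgue. g (x - y) * \<phi>' y = star f (x - y) * \<phi> y"
      using AE_lebesgue_translate[OF ff', of x] \<phi>\<phi>'
      by eventually_elim (simp add: g_def star_def)
    have m: "(\<lambda>y. g (x - y) * \<phi>' y) \<in> borel_measurable borel"
      by measurable
    have "(LINT y|lborel. g (x - y) * \<phi>' y) = (LINT y|lebesgue. g (x - y) * \<phi>' y)"
      using m by (simp add: integral_completion)
    also have "\<dots> = (LINT y|lebesgue. star f (x - y) * \<phi> y)"
      using borel_measurable_AE[OF lebesgueI[OF m] ae] lebesgueI[OF m] ae by (intro integral_cong_AE)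
    finally show ?thesis
      using zero[of x] by (simp add: conv_def)
  qed
  then have "bounded (range (primitive \<phi>'))"
    by (rule primitive_bounded[OF g g0 \<phi>' C'])
  moreover have "P \<phi> x = primitive \<phi>' x" for x
  proof -
    \<comment> \<open>\<open>P\<close> integrates over \<open>lebesgue\<close> and
      \<open>primitive\<close> over \<open>lborel\<close>. Equality on all open intervals covers
      both orientations of the interval integral.\<close>
    have "(LINT y:{a<..<b}|lebesgue. \<phi> y) = (LINT y:{a<..<b}|lborel. \<phi>' y)" for a b
    proof -
      have m: "(\<lambda>y. indicator {a<..<b} y *\<^sub>R \<phi>' y) \<in> borel_measurable borel"
        by measurable
      have "(LINT y:{a<..<b}|lebesgue. \<phi> y) = (LINT y:{a<..<b}|lebesgue. \<phi>' y)"
        unfolding set_lebesgue_integral_def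
      proof (rule integral_cong_AE[OF _ lebesgueI[OF m]])
        show "AE y in lebesgue. indicator {a<..<b} y *\<^sub>R \<phi> y = indicator {a<..<b} y *\<^sub>R \<phi>' y"
          using \<phi>\<phi>' by eventually_elim simp
      qed (intro borel_measurable_scaleR borel_measurable_indicator \<phi>, simp)
      also have "\<dots> = (LINT y:{a<..<b}|lborel. \<phi>' y)"
        unfolding set_lebesgue_integral_def using m by (simp add: integral_completion)
      finally show ?thesis .
    qed
    then show ?thesis
      by (simp add: P_def primitive_def interval_lebesgue_integral_def)
  qed
  ultimately show ?thesis
    by simp
qed

end
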